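(* Let $d\ge 1$ and $N\ge 1$ be integers, $h>0$, $\Delta x_0=\sqrt{3h}$, and for each integer $n\ge 0$ let $$D^n=\left\{(l_1\Delta x_0,\dots,l_d\Delta x_0)\ :\ l_j\in\mathbb{Z},\ |l_j|\le n,\ j=1,\dots,d\right\}\subset\mathbb{R}^d.$$ Let $a_1=-\sqrt{3/2}$, $a_2=0$, $a_3=\sqrt{3/2}$, and for $\mathbf{i}=(i_1,\dots,i_d)\in\{1,2,3\}^d$ let $\mathbf{a}_{\mathbf{i}}=(a_{i_1},\dots,a_{i_d})$. Then: (1) the grids are nested: $\{\mathbf{0}\}=D^0\subset\cdots\subset D^n\subset D^{n+1}\subset\cdots\subset D^N$; (2) for every integer $n\ge 0$, every integer $j\ge 1$ and every $\mathbf{x}\in D^n$, $$\left\{\mathbf{x}+j\sqrt{2h}\,\mathbf{a}_{\mathbf{i}}\ :\ \mathbf{i}\in\{1,2,3\}^d\right\}\subset D^{n+j}\subset D^{n+j^2};$$ (3) $D^N$ has exactly $(2N+1)^d$ elements.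
   Context: The numbers $a_1,a_2,a_3$ are the nodes of the 3-point Gauss-Hermite quadrature rule, i.e. the roots of the Hermite polynomial of degree 3, $H_3(x)=-e^{x^2}\frac{d^3}{dx^3}(e^{-x^2})$. The parameter $h$ is the time step of a uniform time grid. *)

theory Defs
  imports "HOL-Analysis.Analysis"
begin

text \<open>The ambient space is \<open>real ^ 'd\<close> with \<open>'d\<close> an arbitrary finite index type, so the
  dimension is \<open>CARD('d)\<close>, which is automatically at least 1.\<close>

definition dx0 :: "real \<Rightarrow> real" where
  "dx0 h = sqrt (3 * h)"

definition grid :: "real \<Rightarrow> nat \<Rightarrow> (real ^ 'd::finite) set" where
  "grid h n = {(\<chi> j. of_int (l j) * dx0 h) | l :: 'd \<Rightarrow> int. \<forall>j. \<bar>l j\<bar> \<le> int n}"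

text \<open>Only the arguments 1, 2, 3 are meaningful.\<close>

definition gauss_hermite_node :: "nat \<Rightarrow> real" where
  "gauss_hermite_node k =
     (if k = 1 then - sqrt (3 / 2) else if k = 2 then 0 else if k = 3 then sqrt (3 / 2)
      else undefined)"

definition node_vec :: "('d \<Rightarrow> nat) \<Rightarrow> real ^ 'd::finite" where
  "node_vec i = (\<chi> k. gauss_hermite_node (i k))"

end

theory Submission
  imports Defs
begin

text \<open>The spacing is matched to the quadrature: since \<open>sqrt (2 * h) * sqrt (3 / 2) = sqrt (3 * h)\<close>,
  scaling the three Gauss-Hermite nodes by \<open>sqrt (2 * h)\<close> gives exactly \<open>-dx0 h\<close>, \<open>0\<close> and
  \<open>dx0 h\<close> (\<open>scaled_node\<close>). So a shift by \<open>j\<close> scaled nodes moves every coordinate index by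
  \<open>-j\<close>, \<open>0\<close> or \<open>j\<close>, which enlarges the index box by at most \<open>j\<close> and never leaves the lattice
  (\<open>node_shift_in_grid\<close>). Nestedness is monotonicity of the index boxes, and \<open>j \<le> j\<^sup>2\<close> gives the
  second inclusion of part (2). For the count, positivity of \<open>h\<close> makes the parametrization of the
  grid by its index box injective, and the box has \<open>2 * N + 1\<close> choices in each coordinate.\<close>

lemma grid_eq_image:
  "(grid h n :: (real ^ 'd::finite) set) =
     (\<lambda>l. \<chi> j. of_int (l j) * dx0 h) ` (UNIV \<rightarrow>\<^sub>E {- int n..int n})"
proof -
  have "(UNIV \<rightarrow>\<^sub>E {- int n..int n}) = {l :: 'd \<Rightarrow> int. \<forall>j. \<bar>l j\<bar> \<le> int n}"
    by (auto simp: PiE_def Pi_def abs_le_iff minus_le_iff)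
  then show ?thesis
    unfolding grid_def by (simp add: image_Collect)
qed

lemma grid_mono: "m \<le> n \<Longrightarrow> grid h m \<subseteq> grid h n"
  unfolding grid_eq_image by (intro image_mono PiE_mono) auto

lemma grid_0: "grid h 0 = {0}"
  by (auto simp: grid_def vec_eq_iff)

text \<open>This is the only point where the values of the nodes and of the spacing meet; numbering the
  nodes from 1 in increasing order makes the lattice step equal to the number minus 2.\<close>

lemma scaled_node:
  assumes "k \<in> {1, 2, 3}"
  shows "sqrt (2 * h) * gauss_hermite_node k = of_int (int k - 2) * dx0 h"
proof -
  have "sqrt (2 * h) * sqrt (3 / 2) = sqrt (3 * h)"
    by (simp flip: real_sqrt_mult)
  with assms show ?thesis
    by (auto simp: gauss_hermite_node_def dx0_def)
qed

lemma node_shift_in_grid: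
  fixes x :: "real ^ 'd::finite"
  assumes x: "x \<in> grid h n" and i: "\<And>k. i k \<in> {1, 2, 3}"
  shows "x + (real j * sqrt (2 * h)) *\<^sub>R node_vec i \<in> grid h (n + j)"
proof -
  obtain l where l: "x = (\<chi> k. of_int (l k) * dx0 h)" "\<And>k. \<bar>l k\<bar> \<le> int n"
    using x unfolding grid_def by blast
  define l' where "l' k = l k + int j * (int (i k) - 2)" for k
  have "x + (real j * sqrt (2 * h)) *\<^sub>R node_vec i = (\<chi> k. of_int (l' k) * dx0 h)"
    using scaled_node[OF i, of h]
    by (simp add: vec_eq_iff node_vec_def l(1) l'_def mult.assoc distrib_right)
  moreover have "\<bar>l' k\<bar> \<le> int (n + j)" for k
    using l(2)[of k] i[of k] by (auto simp: l'_def)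
  ultimately show ?thesis
    unfolding grid_def by blast
qed

lemma inj_grid_param:
  assumes "h > 0"
  shows "inj (\<lambda>l. (\<chi> j. of_int (l j) * dx0 h) :: real ^ 'd::finite)"
  using assms by (auto simp: inj_def vec_eq_iff dx0_def fun_eq_iff)

lemma finite_grid: "finite (grid h n :: (real ^ 'd::finite) set)"
  by (simp add: grid_eq_image finite_PiE)

lemma card_grid:
  assumes "h > 0"
  shows "card (grid h n :: (real ^ 'd::finite) set) = (2 * n + 1) ^ CARD('d)"
proof -
  have "card (grid h n :: (real ^ 'd) set)
      = card ((UNIV :: 'd set) \<rightarrow>\<^sub>E {- int n..int n})"
    unfolding grid_eq_image
    by (rule card_image) (rule inj_on_subset[OF inj_grid_param[OF assms] subset_UNIV])
  also have "\<dots> = nat (2 * int n + 1) ^ CARD('d)"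
    by (simp add: card_PiE)
  also have "nat (2 * int n + 1) = 2 * n + 1"
    by simp
  finally show ?thesis .
qed

theorem mainTheorem3:
  fixes N :: nat and h :: real
  assumes "N \<ge> 1" and "h > 0"
  shows "(grid h 0 = {0 :: real ^ 'd::finite} \<and>
          (\<forall>n<N. (grid h n :: (real ^ 'd) set) \<subseteq> grid h (n + 1))) \<and>
         (\<forall>(n::nat) (j::nat) (x :: real ^ 'd). j \<ge> 1 \<longrightarrow> x \<in> grid h n \<longrightarrow>
            {x + (real j * sqrt (2 * h)) *\<^sub>R node_vec i | i :: 'd \<Rightarrow> nat. \<forall>k. i k \<in> {1, 2, 3}}
              \<subseteq> grid h (n + j) \<and>
            (grid h (n + j) :: (real ^ 'd) set) \<subseteq> grid h (n + j\<^sup>2)) \<and>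
         (finite (grid h N :: (real ^ 'd) set) \<and>
          card (grid h N :: (real ^ 'd) set) = (2 * N + 1) ^ CARD('d))"
proof (intro conjI allI impI)
  show "grid h 0 = {0 :: real ^ 'd}"
    by (rule grid_0)
  show "(grid h n :: (real ^ 'd) set) \<subseteq> grid h (n + 1)" for n
    by (rule grid_mono) simp
  show "{x + (real j * sqrt (2 * h)) *\<^sub>R node_vec i | i :: 'd \<Rightarrow> nat. \<forall>k. i k \<in> {1, 2, 3}}
      \<subseteq> grid h (n + j)" if "x \<in> grid h n" for n j and x :: "real ^ 'd"
    using node_shift_in_grid[OF that] by blast
  show "(grid h (n + j) :: (real ^ 'd) set) \<subseteq> grid h (n + j\<^sup>2)" for n j
    by (rule grid_mono) (simp add: power2_eq_square)
  show "finite (grid h N :: (real ^ 'd) set)"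
    by (rule finite_grid)
  show "card (grid h N :: (real ^ 'd) set) = (2 * N + 1) ^ CARD('d)"
    using \<open>h > 0\<close> by (rule card_grid)
qed

end
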